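(* Let $\mathcal{C}$ be a general boolean circuit with underlying boolean function $f$. Then the Tseitin translation $\mathrm{ts}(\mathcal{C})$ is a UP-representation of $f$. If $\mathcal{C}$ is in general NNF, then the reduced Tseitin translation $\mathrm{ts}_r(\mathcal{C})$ has usat-recognition via $r_1$ and sat-recognition via $r_{1}^{\mathrm{pl}}$ with respect to $\mathrm{var}(f)$.
   Context: Clauses are finite sets of literals without complementary pairs ($\bot$ empty clause), clause-sets finite sets of clauses read as CNF ($\top$ empty clause-set); $\varphi*F$ applies a partial assignment (delete satisfied clauses, delete falsified literals). $r_1$ is unit-clause propagation ($\{\bot\}$ if $\bot\in F$, otherwise repeatedly apply $\langle x\to 1\rangle$ for unit clauses $\{x\}$). $r_1^{\mathrm{pl}}$ first applies $r_1$ and then repeatedly sets all pure literals (literals $x$ with $\overline{x}$ not occurring) to $1$ until no change. For a boolean function $b$, $\mathrm{prc}_0(b)$ is its set of prime implicates (inclusion-minimal clauses implied by $b$). A general circuit is $\mathcal{C}=(G,I,b,o)$: $G$ a directed acyclic graph whose vertices are variables, $I$ a finite set of input variables disjoint from $V(G)$, $o\in V(G)$ the output node, and $b$ assigns to each vertex $v$ a boolean function $b_v$ with $\mathrm{in}(v)\subseteq\mathrm{var}(b_v)\subseteq\mathrm{in}(v)\cup I$ where $\mathrm{in}(v)$ is the set of vertices with an arc to $v$. The underlying boolean function $f$ of $\mathcal{C}$ is the function computed at $o$ (evaluating from the sources), with $\mathrm{var}(f)$ the set of essential input variables. $\mathrm{ts}(\mathcal{C})=\{\{o\}\}\cup\bigcup_{v\in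 V(G)}\mathrm{prc}_0(v\leftrightarrow b_v)$. $\mathcal{C}$ is in general NNF if each $b_v$ is monotone as a function of the literals over $I$ and of the variables $\mathrm{in}(v)$ (i.e. negative literals in prime implicates of $b_v$ come only from input variables); then $\mathrm{ts}_r(\mathcal{C})=\{\{o\}\}\cup\bigcup_{v}\mathrm{prc}_0(v\to b_v)$. A CNF-representation of $f$ is a clause-set $F$ with $\mathrm{var}(f)\subseteq\mathrm{var}(F)$ such that for every total assignment $\varphi$ of $\mathrm{var}(f)$, $\varphi*F$ is satisfiable iff $f(\varphi)=1$. $F$ has sat-recognition via a map $r$ w.r.t. $V$ if $r(\varphi*F)=\top$ for every total assignment $\varphi$ of $V$ with $\varphi*F$ satisfiable, and usat-recognition via $r$ if $r(\varphi*F)=\{\bot\}$ for every total $\varphi$ of $V$ with $\varphi*F$ unsatisfiable. A UP-representation of $f$ is a CNF-representation with sat- and usat-recognition via $r_1$ w.r.t. $\mathrm{var}(f)$.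
   Formalization: var(f) is taken as the set of inputs essential for at least one gate b_v, not those essential for f itself; with the latter the claim fails, e.g. b_v = i, b_o = v ∨ ¬i, where f = 1 but unit propagation leaves the clauses of v ↔ i. *)

theory Defs
  imports Main
begin

section \<open>Clause-sets and partial assignments\<close>

datatype 'v literal = Pos (lit_var: 'v) | Neg (lit_var: 'v)

primrec complement :: "'v literal \<Rightarrow> 'v literal" where
  "complement (Pos v) = Neg v"
| "complement (Neg v) = Pos v"

type_synonym 'v clause = "'v literal set"
type_synonym 'v passign = "'v \<rightharpoonup> bool"

definition is_clause :: "'v clause \<Rightarrow> bool" where
  "is_clause C \<longleftrightarrow> finite C \<and> (\<forall>x\<in>C. complement x \<notin> C)"

definition is_clause_set :: "'v clause set \<Rightarrow> bool" where
  "is_clause_set F \<longleftrightarrow> finite F \<and> (\<forall>C\<in>F. is_clause C)"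

definition cls_vars :: "'v clause set \<Rightarrow> 'v set" where
  "cls_vars F = lit_var ` \<Union>F"

primrec lit_val :: "'v passign \<Rightarrow> 'v literal \<Rightarrow> bool option" where
  "lit_val \<phi> (Pos v) = \<phi> v"
| "lit_val \<phi> (Neg v) = map_option Not (\<phi> v)"

definition apply_passign :: "'v passign \<Rightarrow> 'v clause set \<Rightarrow> 'v clause set"  (infixr \<open>\<star>\<close> 75) where
  "\<phi> \<star> F = {{x \<in> C. lit_val \<phi> x \<noteq> Some False} | C. C \<in> F \<and> (\<forall>x\<in>C. lit_val \<phi> x \<noteq> Some True)}"

definition satisfiable :: "'v clause set \<Rightarrow> bool" where
  "satisfiable F \<longleftrightarrow> (\<exists>\<phi>. \<phi> \<star> F = {})"

primrec set_true :: "'v literal \<Rightarrow> 'v passign" where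
  "set_true (Pos v) = [v \<mapsto> True]"
| "set_true (Neg v) = [v \<mapsto> False]"


section \<open>Unit-clause propagation and pure literals\<close>

text \<open>
  The recursion terminates on every (finite) clause-set, where its result does not depend on
  the order in which the unit clauses are selected.
\<close>

partial_function (tailrec) r1 :: "'v clause set \<Rightarrow> 'v clause set" where
  "r1 F = (if {} \<in> F then {{}}
           else if \<exists>x. {x} \<in> F then r1 (set_true (SOME x. {x} \<in> F) \<star> F)
           else F)"

definition pure_literals :: "'v clause set \<Rightarrow> 'v literal set" where
  "pure_literals F = {x \<in> \<Union>F. complement x \<notin> \<Union>F}"

definition pure_assign :: "'v clause set \<Rightarrow> 'v passign" where
  "pure_assign F = (\<lambda>v. if Pos v \<in> pure_literals F then Some True
                        else if Neg v \<in> pure_literals F then Some False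
                        else None)"

partial_function (tailrec) pure_elim :: "'v clause set \<Rightarrow> 'v clause set" where
  "pure_elim F = (if pure_assign F \<star> F = F then F else pure_elim (pure_assign F \<star> F))"

definition r1pl :: "'v clause set \<Rightarrow> 'v clause set" where
  "r1pl F = pure_elim (r1 F)"


section \<open>Boolean functions and prime implicates\<close>

text \<open>
  A boolean function is given by a finite set of variables \<open>bvars\<close> together with a map on
  assignments of the whole variable type that depends only on the values on \<open>bvars\<close>.
\<close>

record 'v bool_fun =
  bvars :: "'v set"
  bval :: "('v \<Rightarrow> bool) \<Rightarrow> bool"

definition is_bool_fun :: "'v bool_fun \<Rightarrow> bool" where
  "is_bool_fun b \<longleftrightarrow> finite (bvars b) \<and>
     (\<forall>\<alpha> \<beta>. (\<forall>v\<in>bvars b. \<alpha> v = \<beta> v) \<longrightarrow> bval b \<alpha> = bval b \<beta>)"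

definition essential :: "'v bool_fun \<Rightarrow> 'v set" where
  "essential b = {v. \<exists>\<alpha>. bval b (\<alpha>(v := True)) \<noteq> bval b (\<alpha>(v := False))}"

primrec lit_true :: "('v \<Rightarrow> bool) \<Rightarrow> 'v literal \<Rightarrow> bool" where
  "lit_true \<alpha> (Pos v) = \<alpha> v"
| "lit_true \<alpha> (Neg v) = (\<not> \<alpha> v)"

definition implicate :: "'v bool_fun \<Rightarrow> 'v clause \<Rightarrow> bool" where
  "implicate b C \<longleftrightarrow> is_clause C \<and> (\<forall>\<alpha>. bval b \<alpha> \<longrightarrow> (\<exists>x\<in>C. lit_true \<alpha> x))"

definition prc0 :: "'v bool_fun \<Rightarrow> 'v clause set" where
  "prc0 b = {C. implicate b C \<and> (\<forall>D. D \<subset> C \<longrightarrow> \<not> implicate b D)}"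

definition bf_iff :: "'v \<Rightarrow> 'v bool_fun \<Rightarrow> 'v bool_fun" where
  "bf_iff v b = \<lparr>bvars = insert v (bvars b), bval = (\<lambda>\<alpha>. \<alpha> v \<longleftrightarrow> bval b \<alpha>)\<rparr>"

definition bf_imp :: "'v \<Rightarrow> 'v bool_fun \<Rightarrow> 'v bool_fun" where
  "bf_imp v b = \<lparr>bvars = insert v (bvars b), bval = (\<lambda>\<alpha>. \<alpha> v \<longrightarrow> bval b \<alpha>)\<rparr>"


section \<open>General circuits\<close>

record 'v circuit =
  nodes :: "'v set"
  arcs :: "('v \<times> 'v) set"
  inputs :: "'v set"
  gate :: "'v \<Rightarrow> 'v bool_fun"
  out :: 'v

definition in_nodes :: "'v circuit \<Rightarrow> 'v \<Rightarrow> 'v set" where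
  "in_nodes \<C> v = {u. (u, v) \<in> arcs \<C>}"

definition general_circuit :: "'v circuit \<Rightarrow> bool" where
  "general_circuit \<C> \<longleftrightarrow>
     finite (nodes \<C>) \<and> arcs \<C> \<subseteq> nodes \<C> \<times> nodes \<C> \<and> acyclic (arcs \<C>) \<and>
     finite (inputs \<C>) \<and> inputs \<C> \<inter> nodes \<C> = {} \<and> out \<C> \<in> nodes \<C> \<and>
     (\<forall>v\<in>nodes \<C>. is_bool_fun (gate \<C> v) \<and>
        in_nodes \<C> v \<subseteq> bvars (gate \<C> v) \<and>
        bvars (gate \<C> v) \<subseteq> in_nodes \<C> v \<union> inputs \<C>)"

text \<open>
  The value computed at a node under an assignment of the inputs, by recursion along the arcs;
  see \<open>node_val_unfold\<close> for the recursion equation.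
\<close>

definition node_val :: "'v circuit \<Rightarrow> ('v \<Rightarrow> bool) \<Rightarrow> 'v \<Rightarrow> bool" where
  "node_val \<C> \<alpha> = wfrec (arcs \<C>)
     (\<lambda>val v. bval (gate \<C> v) (\<lambda>u. if u \<in> nodes \<C> then val u else \<alpha> u))"

text \<open>
  The variables of the underlying function are the essential input variables of the circuit:
  the inputs on which at least one gate really depends. All inputs on which the
  output depends are among them (\<open>essential_underlying\<close>), but an input on which
  only gates depend, not the output, is included as well: it occurs in the Tseitin
  translations, and unit-clause propagation does not in general come to an end while it is
  unassigned. For example, with gates \<open>v = i\<close> and \<open>o = v \<or> \<not>i\<close>, where the output is constantly
  true, unit-clause propagation without a value for \<open>i\<close> leaves the clauses of \<open>v \<longleftrightarrow> i\<close>.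
\<close>

definition underlying :: "'v circuit \<Rightarrow> 'v bool_fun" where
  "underlying \<C> =
     \<lparr>bvars = {i \<in> inputs \<C>. \<exists>v\<in>nodes \<C>. i \<in> essential (gate \<C> v)},
      bval = (\<lambda>\<alpha>. node_val \<C> \<alpha> (out \<C>))\<rparr>"

text \<open>
  In general NNF every gate is a monotone function of the positive literals and of the
  negative literals over the inputs; the other negative literals are not available (their
  argument is constantly false).
\<close>

definition general_nnf :: "'v circuit \<Rightarrow> bool" where
  "general_nnf \<C> \<longleftrightarrow>
     (\<forall>v\<in>nodes \<C>. \<exists>g :: ('v literal \<Rightarrow> bool) \<Rightarrow> bool. mono g \<and>
        (\<forall>\<alpha>. bval (gate \<C> v) \<alpha> =
               g (\<lambda>x. case x of Pos u \<Rightarrow> \<alpha> u | Neg u \<Rightarrow> u \<in> inputs \<C> \<and> \<not> \<alpha> u)))"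

definition ts :: "'v circuit \<Rightarrow> 'v clause set" where
  "ts \<C> = {{Pos (out \<C>)}} \<union> (\<Union>v\<in>nodes \<C>. prc0 (bf_iff v (gate \<C> v)))"

definition ts_r :: "'v circuit \<Rightarrow> 'v clause set" where
  "ts_r \<C> = {{Pos (out \<C>)}} \<union> (\<Union>v\<in>nodes \<C>. prc0 (bf_imp v (gate \<C> v)))"


section \<open>Representations\<close>

definition cnf_representation :: "'v clause set \<Rightarrow> 'v bool_fun \<Rightarrow> bool" where
  "cnf_representation F f \<longleftrightarrow> is_clause_set F \<and> bvars f \<subseteq> cls_vars F \<and>
     (\<forall>\<phi>. dom \<phi> = bvars f \<longrightarrow> (satisfiable (\<phi> \<star> F) \<longleftrightarrow> bval f (\<lambda>v. \<phi> v = Some True)))"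

definition sat_recognition ::
  "('v clause set \<Rightarrow> 'v clause set) \<Rightarrow> 'v set \<Rightarrow> 'v clause set \<Rightarrow> bool" where
  "sat_recognition r V F \<longleftrightarrow> (\<forall>\<phi>. dom \<phi> = V \<and> satisfiable (\<phi> \<star> F) \<longrightarrow> r (\<phi> \<star> F) = {})"

definition usat_recognition ::
  "('v clause set \<Rightarrow> 'v clause set) \<Rightarrow> 'v set \<Rightarrow> 'v clause set \<Rightarrow> bool" where
  "usat_recognition r V F \<longleftrightarrow> (\<forall>\<phi>. dom \<phi> = V \<and> \<not> satisfiable (\<phi> \<star> F) \<longrightarrow> r (\<phi> \<star> F) = {{}})"

definition up_representation :: "'v clause set \<Rightarrow> 'v bool_fun \<Rightarrow> bool" where
  "up_representation F f \<longleftrightarrow> cnf_representation F f \<and>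
     sat_recognition r1 (bvars f) F \<and> usat_recognition r1 (bvars f) F"


section \<open>Basic facts about the underlying function\<close>

lemma wf_arcs:
  assumes "general_circuit \<C>"
  shows "wf (arcs \<C>)"
proof (rule finite_acyclic_wf)
  show "finite (arcs \<C>)"
    using assms finite_subset unfolding general_circuit_def by blast
  show "acyclic (arcs \<C>)"
    using assms unfolding general_circuit_def by blast
qed

lemma node_val_unfold:
  assumes \<C>: "general_circuit \<C>" and v: "v \<in> nodes \<C>"
  shows "node_val \<C> \<alpha> v =
    bval (gate \<C> v) (\<lambda>u. if u \<in> nodes \<C> then node_val \<C> \<alpha> u else \<alpha> u)"
proof -
  have b: "is_bool_fun (gate \<C> v)" and sub: "bvars (gate \<C> v) \<subseteq> in_nodes \<C> v \<union> inputs \<C>"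
    and disj: "inputs \<C> \<inter> nodes \<C> = {}"
    using \<C> v unfolding general_circuit_def by blast+
  have "node_val \<C> \<alpha> v = bval (gate \<C> v)
      (\<lambda>u. if u \<in> nodes \<C> then cut (node_val \<C> \<alpha>) (arcs \<C>) v u else \<alpha> u)"
    unfolding node_val_def by (subst wfrec[OF wf_arcs[OF \<C>]]) simp
  also have "\<dots> = bval (gate \<C> v) (\<lambda>u. if u \<in> nodes \<C> then node_val \<C> \<alpha> u else \<alpha> u)"
    (is "bval _ ?l = bval _ ?r")
  proof -
    have "\<forall>u\<in>bvars (gate \<C> v). ?l u = ?r u"
      using sub disj by (auto simp: cut_def in_nodes_def)
    moreover have "(\<forall>u\<in>bvars (gate \<C> v). ?l u = ?r u) \<longrightarrow> bval (gate \<C> v) ?l = bval (gate \<C> v) ?r"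
      using b unfolding is_bool_fun_def by (elim conjE) (erule allE, erule allE)
    ultimately show ?thesis by (rule rev_mp)
  qed
  finally show ?thesis .
qed

lemma essential_determines:
  assumes b: "is_bool_fun b" and eq: "\<And>v. v \<in> essential b \<Longrightarrow> \<alpha> v = \<beta> v"
  shows "bval b \<alpha> = bval b \<beta>"
proof -
  have step: "bval b (\<gamma>(v := x)) = bval b \<gamma>" if "v \<notin> essential b" for \<gamma> v x
  proof -
    have "bval b (\<gamma>(v := True)) = bval b (\<gamma>(v := False))"
      using that unfolding essential_def by blast
    then have "bval b (\<gamma>(v := x)) = bval b (\<gamma>(v := \<gamma> v))"
      by (cases x; cases "\<gamma> v") simp_all
    then show ?thesis by simp
  qed
  define mix where "mix S = (\<lambda>v. if v \<in> S then \<beta> v else \<alpha> v)" for S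
  have "bval b (mix S) = bval b \<alpha>" if "finite S" for S
    using that
  proof (induction S)
    case empty
    have "mix {} = \<alpha>" by (simp add: mix_def)
    then show ?case by simp
  next
    case (insert w S)
    have g: "mix (insert w S) = (mix S)(w := \<beta> w)" by (rule ext) (simp add: mix_def)
    show ?case
    proof (cases "w \<in> essential b")
      case True
      then have "(mix S)(w := \<beta> w) = mix S" using insert.hyps eq by (simp add: mix_def fun_eq_iff)
      then show ?thesis unfolding g using insert.IH by simp
    next
      case False
      then show ?thesis unfolding g insert.IH[symmetric] by (rule step)
    qed
  qed
  then have "bval b (mix (bvars b)) = bval b \<alpha>"
    using b unfolding is_bool_fun_def by blast
  moreover have "\<forall>v\<in>bvars b. mix (bvars b) v = \<beta> v" by (simp add: mix_def)
  then have "bval b (mix (bvars b)) = bval b \<beta>"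
    using b unfolding is_bool_fun_def by blast
  ultimately show ?thesis by simp
qed

lemma is_bool_fun_underlying:
  assumes \<C>: "general_circuit \<C>"
  shows "is_bool_fun (underlying \<C>)"
proof -
  let ?V = "bvars (underlying \<C>)"
  have "node_val \<C> \<alpha> v = node_val \<C> \<beta> v"
    if eq: "\<forall>u\<in>?V. \<alpha> u = \<beta> u" and "v \<in> nodes \<C>" for \<alpha> \<beta> v
    using \<open>v \<in> nodes \<C>\<close>
  proof (induction v rule: wf_induct_rule[OF wf_arcs[OF \<C>]])
    case (1 v)
    have b: "is_bool_fun (gate \<C> v)" and sub: "bvars (gate \<C> v) \<subseteq> in_nodes \<C> v \<union> inputs \<C>"
      and disj: "inputs \<C> \<inter> nodes \<C> = {}"
      using \<C> 1 unfolding general_circuit_def by blast+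
    have ess: "essential (gate \<C> v) \<subseteq> bvars (gate \<C> v)"
    proof
      fix u assume "u \<in> essential (gate \<C> v)"
      then obtain \<gamma> where \<gamma>: "bval (gate \<C> v) (\<gamma>(u := True)) \<noteq> bval (gate \<C> v) (\<gamma>(u := False))"
        unfolding essential_def by blast
      show "u \<in> bvars (gate \<C> v)"
      proof (rule ccontr)
        assume "u \<notin> bvars (gate \<C> v)"
        then have "\<forall>w\<in>bvars (gate \<C> v). (\<gamma>(u := True)) w = (\<gamma>(u := False)) w" by auto
        then show False using b \<gamma> unfolding is_bool_fun_def by blast
      qed
    qed
    have "(if u \<in> nodes \<C> then node_val \<C> \<alpha> u else \<alpha> u)
        = (if u \<in> nodes \<C> then node_val \<C> \<beta> u else \<beta> u)"
      if u: "u \<in> essential (gate \<C> v)" for u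
    proof (cases "u \<in> nodes \<C>")
      case True
      then have "(u, v) \<in> arcs \<C>" using u ess sub disj by (auto simp: in_nodes_def)
      then show ?thesis using 1 True by simp
    next
      case False
      then have "u \<in> inputs \<C>"
        using u ess sub \<C> by (auto simp: in_nodes_def general_circuit_def)
      then have "u \<in> ?V" using u 1 by (auto simp: underlying_def)
      then show ?thesis using False eq by simp
    qed
    from essential_determines[OF b this] show ?case
      using node_val_unfold[OF \<C> 1(2)] by simp
  qed
  moreover have "out \<C> \<in> nodes \<C>" "finite ?V"
    using \<C> by (auto simp: general_circuit_def underlying_def)
  ultimately show ?thesis
    unfolding is_bool_fun_def by (auto simp: underlying_def)
qed

lemma essential_underlying:
  assumes "general_circuit \<C>"
  shows "essential (underlying \<C>) \<subseteq> bvars (underlying \<C>)"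
proof
  fix u assume "u \<in> essential (underlying \<C>)"
  then obtain \<gamma> where \<gamma>: "bval (underlying \<C>) (\<gamma>(u := True)) \<noteq> bval (underlying \<C>) (\<gamma>(u := False))"
    unfolding essential_def by blast
  show "u \<in> bvars (underlying \<C>)"
  proof (rule ccontr)
    assume "u \<notin> bvars (underlying \<C>)"
    then have "\<forall>w\<in>bvars (underlying \<C>). (\<gamma>(u := True)) w = (\<gamma>(u := False)) w" by auto
    then show False
      using is_bool_fun_underlying[OF assms] \<gamma> unfolding is_bool_fun_def by blast
  qed
qed

end

theory Submission
  imports Defs
begin

text \<open>
  Unit-clause propagation stops either with a refutation or with a residue \<open>\<theta> \<star> F\<close> that
  contains neither the empty clause nor a unit clause. For \<open>ts\<close>, an induction along the arcs shows
  that in the second case every node is assigned by \<open>\<theta>\<close>: as soon as the predecessors of \<open>v\<close> are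
  assigned, some prime implicate of \<open>v \<longleftrightarrow> b\<^sub>v\<close> shrinks to a clause with at most one literal. Hence
  the residue is empty. For \<open>ts_r\<close> of a circuit in general NNF, every clause of the residue consists
  of positive literals on predecessors of some node \<open>v\<close> and possibly \<open>\<not>v\<close>. Having at least two
  literals, it contains a positive one, so the residue is satisfied by setting all nodes to true;
  moreover a minimal occurring node occurs only positively, so pure literal elimination
  never gets stuck before the residue is empty.
\<close>

section \<open>Partial assignments\<close>

text \<open>Boolean functions are evaluated at total assignments, whereas \<open>satisfiable\<close>
  is defined through partial ones; \<open>satisfies\<close> and \<open>extends\<close> form the
  bridge.\<close>

definition satisfies :: "('v \<Rightarrow> bool) \<Rightarrow> 'v clause set \<Rightarrow> bool" where
  "satisfies \<alpha> F \<longleftrightarrow> (\<forall>C\<in>F. \<exists>x\<in>C. lit_true \<alpha> x)"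

definition extends :: "('v \<Rightarrow> bool) \<Rightarrow> 'v passign \<Rightarrow> bool" where
  "extends \<alpha> \<phi> \<longleftrightarrow> (\<forall>v b. \<phi> v = Some b \<longrightarrow> \<alpha> v = b)"

lemma lit_val_None_iff: "lit_val \<phi> x = None \<longleftrightarrow> \<phi> (lit_var x) = None"
  by (cases x) auto

lemma lit_val_extends: "extends \<alpha> \<phi> \<Longrightarrow> lit_val \<phi> x = Some b \<Longrightarrow> lit_true \<alpha> x = b"
  by (cases x) (auto simp: extends_def)

lemma lit_val_map_add:
  "lit_val (\<psi> ++ \<phi>) x = (case lit_val \<phi> x of None \<Rightarrow> lit_val \<psi> x | Some b \<Rightarrow> Some b)"
  by (cases x) (auto simp: map_add_def split: option.splits)

text \<open>Since \<open>\<phi>\<close> acts first, its values must win, and the right operand of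
  \<open>++\<close> does win: \<open>\<psi>\<close> never meets a literal that \<open>\<phi>\<close>
  has assigned.\<close>

lemma apply_passign_map_add: "\<psi> \<star> (\<phi> \<star> F) = (\<psi> ++ \<phi>) \<star> F"
proof -
  let ?r = "\<lambda>\<phi> C. {x \<in> C. lit_val \<phi> x \<noteq> Some False}"
  let ?u = "\<lambda>\<phi> C. \<forall>x\<in>C. lit_val \<phi> x \<noteq> Some True"
  have r: "?r (\<psi> ++ \<phi>) C = ?r \<psi> (?r \<phi> C)" if "?u \<phi> C" for C
    using that by (auto simp: lit_val_map_add split: option.splits)
  have u: "?u (\<psi> ++ \<phi>) C \<longleftrightarrow> ?u \<phi> C \<and> ?u \<psi> (?r \<phi> C)" for C
    by (auto simp: lit_val_map_add split: option.splits) (metis option.exhaust)+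
  have "\<psi> \<star> (\<phi> \<star> F) = {?r \<psi> (?r \<phi> C) | C. C \<in> F \<and> ?u \<phi> C \<and> ?u \<psi> (?r \<phi> C)}"
    unfolding apply_passign_def by blast
  also have "\<dots> = {?r (\<psi> ++ \<phi>) C | C. C \<in> F \<and> ?u (\<psi> ++ \<phi>) C}"
    unfolding u using r by blast
  finally show ?thesis unfolding apply_passign_def .
qed

lemma apply_passign_empty: "Map.empty \<star> F = F"
proof -
  have "lit_val Map.empty x = None" for x :: "'a literal" by (simp add: lit_val_None_iff)
  then show ?thesis by (simp add: apply_passign_def)
qed

text \<open>A surviving literal was not false, and its clause would have been dropped had it been
  true, so it is unassigned.\<close>

lemma apply_passign_subclause:
  assumes "D \<in> \<phi> \<star> F"
  obtains C where "C \<in> F" "D \<subseteq> C" "\<And>x. x \<in> D \<Longrightarrow> \<phi> (lit_var x) = None"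
proof -
  obtain C where C: "C \<in> F" "D = {x \<in> C. lit_val \<phi> x \<noteq> Some False}"
    "\<forall>x\<in>C. lit_val \<phi> x \<noteq> Some True"
    using assms unfolding apply_passign_def by blast
  have "lit_val \<phi> x = None" if "x \<in> D" for x
    using that C by (cases "lit_val \<phi> x") auto
  then show ?thesis using that[of C] C lit_val_None_iff by auto
qed

lemma cls_vars_apply_passign: "cls_vars (\<phi> \<star> F) \<subseteq> cls_vars F - dom \<phi>"
proof
  fix v assume "v \<in> cls_vars (\<phi> \<star> F)"
  then obtain D x where D: "D \<in> \<phi> \<star> F" "x \<in> D" "v = lit_var x" by (auto simp: cls_vars_def)
  obtain C where "C \<in> F" "D \<subseteq> C" "\<And>x. x \<in> D \<Longrightarrow> \<phi> (lit_var x) = None"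
    using apply_passign_subclause[OF D(1)] by blast
  with D show "v \<in> cls_vars F - dom \<phi>" by (auto simp: cls_vars_def)
qed

lemma finite_apply_passign: "finite F \<Longrightarrow> finite (\<phi> \<star> F)"
  unfolding apply_passign_def by simp

lemma apply_passign_eq_empty_iff:
  "\<phi> \<star> F = {} \<longleftrightarrow> (\<forall>C\<in>F. \<exists>x\<in>C. lit_val \<phi> x = Some True)"
  by (auto simp: apply_passign_def)

lemma satisfiable_iff: "satisfiable F \<longleftrightarrow> (\<exists>\<alpha>. satisfies \<alpha> F)"
proof
  assume "satisfiable F"
  then obtain \<phi> where \<phi>: "\<forall>C\<in>F. \<exists>x\<in>C. lit_val \<phi> x = Some True"
    by (auto simp: satisfiable_def apply_passign_eq_empty_iff)
  \<comment> \<open>Unassigned variables default to False; this does no harm, as every clause has a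
    literal that \<open>\<phi>\<close> itself makes true.\<close>
  have "extends (\<lambda>v. \<phi> v = Some True) \<phi>" by (auto simp: extends_def)
  from lit_val_extends[OF this] have "satisfies (\<lambda>v. \<phi> v = Some True) F"
    using \<phi> unfolding satisfies_def by metis
  then show "\<exists>\<alpha>. satisfies \<alpha> F" by blast
next
  assume "\<exists>\<alpha>. satisfies \<alpha> F"
  then obtain \<alpha> where \<alpha>: "satisfies \<alpha> F" ..
  have "lit_val (\<lambda>v. Some (\<alpha> v)) x = Some (lit_true \<alpha> x)" for x by (cases x) auto
  then have "(\<lambda>v. Some (\<alpha> v)) \<star> F = {}"
    using \<alpha> by (simp add: apply_passign_eq_empty_iff satisfies_def)
  then show "satisfiable F" unfolding satisfiable_def by (rule exI[of _ "\<lambda>v. Some (\<alpha> v)"])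
qed

lemma satisfiable_apply_passignD: "satisfiable (\<phi> \<star> F) \<Longrightarrow> satisfiable F"
  unfolding satisfiable_def by (auto simp: apply_passign_map_add)

text \<open>For an assignment agreeing with \<open>\<phi>\<close>, the dropped clauses are true and
  the deleted literals false anyway.\<close>

lemma satisfies_apply_passign:
  assumes "extends \<alpha> \<phi>"
  shows "satisfies \<alpha> (\<phi> \<star> F) \<longleftrightarrow> satisfies \<alpha> F"
proof -
  have true: "lit_true \<alpha> x" if "lit_val \<phi> x = Some True" for x
    using lit_val_extends[OF assms that] by simp
  have false: "\<not> lit_true \<alpha> x" if "lit_val \<phi> x = Some False" for x
    using lit_val_extends[OF assms that] by simp
  show ?thesis
  proof
    assume L: "satisfies \<alpha> (\<phi> \<star> F)"
    show "satisfies \<alpha> F"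
      unfolding satisfies_def
    proof
      fix C assume "C \<in> F"
      show "\<exists>x\<in>C. lit_true \<alpha> x"
      proof (cases "\<exists>x\<in>C. lit_val \<phi> x = Some True")
        case True
        then show ?thesis using true by blast
      next
        case False
        then have "{x \<in> C. lit_val \<phi> x \<noteq> Some False} \<in> \<phi> \<star> F"
          using \<open>C \<in> F\<close> unfolding apply_passign_def by blast
        from bspec[OF L[unfolded satisfies_def] this] show ?thesis by blast
      qed
    qed
  next
    assume R: "satisfies \<alpha> F"
    show "satisfies \<alpha> (\<phi> \<star> F)"
      unfolding satisfies_def
    proof
      fix D assume "D \<in> \<phi> \<star> F"
      then obtain C where C: "C \<in> F" "D = {x \<in> C. lit_val \<phi> x \<noteq> Some False}"
        unfolding apply_passign_def by blast
      then obtain x where "x \<in> C" "lit_true \<alpha> x" using R unfolding satisfies_def by blast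
      then show "\<exists>x\<in>D. lit_true \<alpha> x" using C(2) false by blast
    qed
  qed
qed

lemma satisfiable_apply_passign_iff:
  "satisfiable (\<phi> \<star> F) \<longleftrightarrow> (\<exists>\<alpha>. extends \<alpha> \<phi> \<and> satisfies \<alpha> F)"
proof
  assume "satisfiable (\<phi> \<star> F)"
  then obtain \<alpha> where \<alpha>: "satisfies \<alpha> (\<phi> \<star> F)" unfolding satisfiable_iff ..
  \<comment> \<open>\<open>\<alpha>\<close> may contradict \<open>\<phi>\<close>; overwriting it by
    \<open>\<phi>\<close> is harmless, since no variable assigned by \<open>\<phi>\<close> occurs in
    the reduct.\<close>
  define \<beta> where "\<beta> v = (case \<phi> v of None \<Rightarrow> \<alpha> v | Some b \<Rightarrow> b)" for v
  have \<beta>: "extends \<beta> \<phi>" by (auto simp: extends_def \<beta>_def)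
  have "\<exists>x\<in>D. lit_true \<beta> x" if D: "D \<in> \<phi> \<star> F" for D
  proof -
    obtain x where x: "x \<in> D" "lit_true \<alpha> x" using \<alpha> D unfolding satisfies_def by blast
    have "\<phi> (lit_var x) = None" using apply_passign_subclause[OF D] x(1) by blast
    then have "lit_true \<beta> x" using x(2) by (cases x) (auto simp: \<beta>_def)
    then show ?thesis using x(1) ..
  qed
  then have "satisfies \<beta> (\<phi> \<star> F)" unfolding satisfies_def ..
  then show "\<exists>\<alpha>. extends \<alpha> \<phi> \<and> satisfies \<alpha> F" using \<beta> satisfies_apply_passign by blast
next
  assume "\<exists>\<alpha>. extends \<alpha> \<phi> \<and> satisfies \<alpha> F"
  then show "satisfiable (\<phi> \<star> F)" using satisfies_apply_passign satisfiable_iff by blast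
qed

section \<open>Unit-clause propagation and pure literals\<close>

text \<open>Each propagation step eliminates the variable of a unit clause, so the tail recursion is
  handled by induction on the number of occurring variables; \<open>\<psi>\<close> collects the
  assignments made. Nothing depends on which unit clause \<open>SOME\<close> picks.\<close>

lemma r1_residue:
  assumes "finite (cls_vars F)"
  shows "r1 F = {{}} \<and> \<not> satisfiable F \<or>
    (\<exists>\<psi>. r1 F = \<psi> \<star> F \<and> {} \<notin> r1 F \<and> (\<forall>x. {x} \<notin> r1 F))"
  using assms
proof (induction "card (cls_vars F)" arbitrary: F rule: less_induct)
  case less
  consider (empty) "{} \<in> F" | (unit) "{} \<notin> F" "\<exists>x. {x} \<in> F" | (stop) "{} \<notin> F" "\<nexists>x. {x} \<in> F"
    by blast
  then show ?case
  proof cases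
    case empty
    then have "\<not> satisfiable F" by (auto simp: satisfiable_iff satisfies_def)
    then show ?thesis using empty by (simp add: r1.simps[of F])
  next
    case unit
    define x where "x = (SOME x. {x} \<in> F)"
    have x: "{x} \<in> F" unfolding x_def using unit(2) by (rule someI_ex)
    let ?G = "set_true x \<star> F"
    have r: "r1 F = r1 ?G" using unit by (simp add: r1.simps[of F] x_def)
    have "lit_var x \<in> cls_vars F" using x unfolding cls_vars_def by blast
    moreover have "lit_var x \<in> dom (set_true x)" by (cases x) auto
    ultimately have sub: "cls_vars ?G \<subset> cls_vars F"
      using cls_vars_apply_passign[of "set_true x" F] by blast
    have IH: "r1 ?G = {{}} \<and> \<not> satisfiable ?G \<or>
        (\<exists>\<psi>. r1 ?G = \<psi> \<star> ?G \<and> {} \<notin> r1 ?G \<and> (\<forall>x. {x} \<notin> r1 ?G))"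
      using less psubset_card_mono[OF _ sub] finite_subset[OF psubset_imp_subset[OF sub]] by blast
    \<comment> \<open>A model of \<open>F\<close> makes the unit literal true and thus satisfies the
      reduct; contraposed, this carries unsatisfiability back to \<open>F\<close>.\<close>
    have "satisfiable ?G" if sat: "satisfiable F"
    proof -
      obtain \<alpha> where \<alpha>: "satisfies \<alpha> F" using sat unfolding satisfiable_iff ..
      then have "lit_true \<alpha> x" using x unfolding satisfies_def by blast
      then have "extends \<alpha> (set_true x)" by (cases x) (auto simp: extends_def)
      then show ?thesis using \<alpha> satisfiable_apply_passign_iff by blast
    qed
    then show ?thesis using IH unfolding r apply_passign_map_add by blast
  next
    case stop
    then have "r1 F = F" by (simp add: r1.simps[of F])
    then show ?thesis using stop apply_passign_empty by metis
  qed
qed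

text \<open>The complement of a pure literal does not occur, so no clause shrinks and a round merely
  removes clauses.\<close>

lemma apply_pure_assign: "pure_assign F \<star> F = {C \<in> F. C \<inter> pure_literals F = {}}"
proof -
  have t: "lit_val (pure_assign F) x = Some True \<longleftrightarrow> x \<in> pure_literals F" for x
    by (cases x) (auto simp: pure_assign_def pure_literals_def)
  have f: "lit_val (pure_assign F) x \<noteq> Some False" if "C \<in> F" "x \<in> C" for x C
    using that by (cases x) (auto simp: pure_assign_def pure_literals_def)
  have "{x \<in> C. lit_val (pure_assign F) x \<noteq> Some False} = C" if "C \<in> F" for C
    using f[OF that] by blast
  then show ?thesis unfolding apply_passign_def t by fastforce
qed

text \<open>The shape of the residues of reduced Tseitin translations, with \<open>R\<close> the arcs of the circuit.\<close>

definition dag_dual_horn :: "('v \<times> 'v) set \<Rightarrow> 'v clause set \<Rightarrow> bool" where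
  "dag_dual_horn R F \<longleftrightarrow> (\<forall>C\<in>F. \<exists>v. C \<subseteq> insert (Neg v) {Pos u | u. (u, v) \<in> R})"

lemma dag_dual_horn_apply_passign:
  assumes "dag_dual_horn R F"
  shows "dag_dual_horn R (\<phi> \<star> F)"
  unfolding dag_dual_horn_def
proof
  fix D assume "D \<in> \<phi> \<star> F"
  then obtain C where "C \<in> F" "D \<subseteq> C" by (rule apply_passign_subclause)
  then show "\<exists>v. D \<subseteq> insert (Neg v) {Pos u | u. (u, v) \<in> R}"
    using assms unfolding dag_dual_horn_def by (meson subset_trans)
qed

text \<open>\<open>Neg v\<close> is the only negative literal allowed, so any further literal is
  positive.\<close>

lemma dag_dual_horn_positive_literal:
  assumes "C \<noteq> {}" "\<And>x. C \<noteq> {x}" "C \<subseteq> insert (Neg v) {Pos u | u. (u, v) \<in> R}"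
  obtains u where "Pos u \<in> C" "(u, v) \<in> R"
proof -
  have "\<not> C \<subseteq> {Neg v}" using assms(1,2) by (metis subset_singletonD)
  then obtain x where "x \<in> C" "x \<noteq> Neg v" by blast
  then show ?thesis using assms(3) that by blast
qed

lemma satisfiable_dag_dual_horn:
  assumes "dag_dual_horn R F" "{} \<notin> F" "\<And>x. {x} \<notin> F"
  shows "satisfiable F"
proof -
  have "\<exists>x\<in>C. lit_true (\<lambda>_. True) x" if C: "C \<in> F" for C
  proof -
    obtain v where "C \<subseteq> insert (Neg v) {Pos u | u. (u, v) \<in> R}"
      using assms(1) C unfolding dag_dual_horn_def by blast
    moreover have "C \<noteq> {}" "\<And>x. C \<noteq> {x}" using assms(2,3) C by auto
    ultimately obtain u where "Pos u \<in> C" using dag_dual_horn_positive_literal[of C v R] by blast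
    then show ?thesis by force
  qed
  then show ?thesis unfolding satisfiable_iff satisfies_def by blast
qed

text \<open>Every round on a nonempty clause-set removes a clause, and the remaining ones, being
  unchanged clauses of \<open>F\<close>, keep all hypotheses; hence the induction over proper
  subsets.\<close>

lemma pure_elim_dag_dual_horn:
  assumes "finite F" "wf R" "dag_dual_horn R F" "{} \<notin> F" "\<And>x. {x} \<notin> F"
  shows "pure_elim F = {}"
  using assms(1,3-)
proof (induction F rule: finite_psubset_induct)
  case (psubset F)
  let ?G = "pure_assign F \<star> F"
  show ?case
  proof (cases "F = {}")
    case True
    then have "?G = F" by (simp add: apply_passign_def)
    then have "pure_elim F = F" by (subst pure_elim.simps) simp
    then show ?thesis using True by simp
  next
    case False
    have pos: "\<exists>u. Pos u \<in> C \<and> (u, v) \<in> R"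
      if "C \<in> F" "C \<subseteq> insert (Neg v) {Pos u | u. (u, v) \<in> R}" for C v
    proof -
      have "C \<noteq> {}" "\<And>x. C \<noteq> {x}" using psubset.prems(2,3) that(1) by auto
      then show ?thesis using dag_dual_horn_positive_literal[OF _ _ that(2)] by blast
    qed
    obtain C where C: "C \<in> F" using False by blast
    then obtain v where "C \<subseteq> insert (Neg v) {Pos u | u. (u, v) \<in> R}"
      using psubset.prems(1) unfolding dag_dual_horn_def by blast
    then obtain u where "Pos u \<in> C" using pos[OF C] by blast
    then have "u \<in> {u. Pos u \<in> \<Union>F}" using C by blast
    \<comment> \<open>\<open>w\<close> is minimal along \<open>R\<close> among the variables that
      occur positively; it turns out to be pure.\<close>
    from wfE_min[OF assms(2) this] obtain w
      where w: "Pos w \<in> \<Union>F" and min: "\<And>u. (u, w) \<in> R \<Longrightarrow> Pos u \<notin> \<Union>F"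
      by (metis mem_Collect_eq)
    \<comment> \<open>A clause containing \<open>Neg w\<close> has a positive literal on a
      predecessor of \<open>w\<close>, against minimality.\<close>
    have "Neg w \<notin> \<Union>F"
    proof
      assume "Neg w \<in> \<Union>F"
      then obtain C where C: "C \<in> F" "Neg w \<in> C" by blast
      then obtain v where v: "C \<subseteq> insert (Neg v) {Pos u | u. (u, v) \<in> R}"
        using psubset.prems(1) unfolding dag_dual_horn_def by blast
      then have "v = w" using C(2) by blast
      then show False using pos[OF C(1) v] min C(1) by blast
    qed
    then have "Pos w \<in> pure_literals F" using w by (simp add: pure_literals_def)
    then have G: "?G \<subset> F" using w unfolding apply_pure_assign by blast
    have "pure_elim ?G = {}"
      using psubset.IH[OF G] psubset.prems dag_dual_horn_apply_passign G by blast
    moreover have "?G \<noteq> F" using G by blast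
    ultimately show ?thesis by (simp add: pure_elim.simps[of F])
  qed
qed

section \<open>Prime implicates\<close>

lemma is_bool_fun_cong:
  assumes "is_bool_fun b" "\<forall>v\<in>bvars b. \<alpha> v = \<beta> v"
  shows "bval b \<alpha> = bval b \<beta>"
proof -
  have "(\<forall>v\<in>bvars b. \<alpha> v = \<beta> v) \<longrightarrow> bval b \<alpha> = bval b \<beta>"
    using assms(1) unfolding is_bool_fun_def by (elim conjE) (erule allE, erule allE)
  then show ?thesis using assms(2) by (rule mp)
qed

lemma essential_subset_bvars:
  assumes "is_bool_fun b"
  shows "essential b \<subseteq> bvars b"
proof (rule ccontr)
  assume "\<not> essential b \<subseteq> bvars b"
  then obtain v \<alpha> where "v \<notin> bvars b" "bval b (\<alpha>(v := True)) \<noteq> bval b (\<alpha>(v := False))"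
    unfolding essential_def by blast
  moreover from this have "\<forall>u\<in>bvars b. (\<alpha>(v := True)) u = (\<alpha>(v := False)) u" by auto
  ultimately show False using is_bool_fun_cong[OF assms] by metis
qed

lemma finite_essential: "is_bool_fun b \<Longrightarrow> finite (essential b)"
  using finite_subset[OF essential_subset_bvars[of b]] unfolding is_bool_fun_def by blast

text \<open>Clauses are finite, so some implicate inside \<open>C\<close> is minimal there; a
  smaller implicate would also lie inside \<open>C\<close>.\<close>

lemma implicate_contains_prime:
  assumes "implicate b C"
  obtains D where "D \<in> prc0 b" "D \<subseteq> C"
proof -
  have "finite C" using assms by (simp add: implicate_def is_clause_def)
  then have "finite {D. D \<subseteq> C \<and> implicate b D}" by simp
  moreover have "C \<in> {D. D \<subseteq> C \<and> implicate b D}" using assms by simp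
  ultimately obtain D where D: "D \<subseteq> C" "implicate b D"
    and min: "\<forall>E\<in>{D. D \<subseteq> C \<and> implicate b D}. E \<le> D \<longrightarrow> D = E"
    using finite_has_minimal2[of "{D. D \<subseteq> C \<and> implicate b D}" C] by auto
  have "\<not> implicate b E" if "E \<subset> D" for E
    using min that D(1) by auto
  then have "D \<in> prc0 b" using D(2) unfolding prc0_def by blast
  then show ?thesis using D(1) that by blast
qed

text \<open>Take the clause of all literals over essential variables that are false at
  \<open>\<alpha>\<close>. A model of \<open>b\<close> differs from \<open>\<alpha>\<close> at some
  essential variable and so satisfies this clause. Hence it is an implicate, and a prime implicate
  inside it is as required.\<close>

lemma falsified_prime_implicate:
  assumes b: "is_bool_fun b" and "\<not> bval b \<alpha>"
  obtains C where "C \<in> prc0 b" "\<And>x. x \<in> C \<Longrightarrow> \<not> lit_true \<alpha> x \<and> lit_var x \<in> essential b"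
proof -
  let ?C = "(\<lambda>v. if \<alpha> v then Neg v else Pos v) ` essential b"
  have "is_clause ?C"
    unfolding is_clause_def using finite_essential[OF b] by (auto split: if_splits)
  moreover have "\<exists>x\<in>?C. lit_true \<beta> x" if \<beta>: "bval b \<beta>" for \<beta>
  proof -
    obtain v where "v \<in> essential b" "\<alpha> v \<noteq> \<beta> v"
      using essential_determines[OF b, of \<alpha> \<beta>] \<beta> assms(2) by blast
    then show ?thesis by force
  qed
  ultimately have "implicate b ?C" unfolding implicate_def by blast
  then obtain D where D: "D \<in> prc0 b" "D \<subseteq> ?C" by (rule implicate_contains_prime)
  have "\<not> lit_true \<alpha> x \<and> lit_var x \<in> essential b" if "x \<in> D" for x
    using that D(2) by (auto split: if_splits)
  then show ?thesis using D(1) that by blast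
qed

lemma satisfies_prc0:
  assumes "is_bool_fun b"
  shows "satisfies \<alpha> (prc0 b) \<longleftrightarrow> bval b \<alpha>"
proof
  show "satisfies \<alpha> (prc0 b)" if "bval b \<alpha>"
    using that by (simp add: satisfies_def prc0_def implicate_def)
  show "bval b \<alpha>" if "satisfies \<alpha> (prc0 b)"
    using that falsified_prime_implicate[OF assms] unfolding satisfies_def by metis
qed

text \<open>By primality some model of \<open>b\<close> falsifies \<open>C - {x}\<close>. There
  \<open>x\<close> is the only true literal of \<open>C\<close>, and flipping its variable falsifies
  \<open>C\<close> and therefore \<open>b\<close>. Both the variables and the signs occurring in
  prime implicates are controlled through this.\<close>

lemma prime_implicate_literal:
  assumes "C \<in> prc0 b" "x \<in> C"
  obtains \<alpha> where "bval b \<alpha>" "lit_true \<alpha> x"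
    "\<not> bval b (\<alpha>(lit_var x := \<not> \<alpha> (lit_var x)))"
proof -
  have C: "implicate b C" and "\<not> implicate b (C - {x})"
    using assms by (auto simp: prc0_def)
  moreover have "is_clause (C - {x})" using C by (auto simp: implicate_def is_clause_def)
  ultimately obtain \<alpha> where \<alpha>: "bval b \<alpha>" "\<forall>y\<in>C - {x}. \<not> lit_true \<alpha> y"
    unfolding implicate_def by blast
  let ?\<beta> = "\<alpha>(lit_var x := \<not> \<alpha> (lit_var x))"
  have x: "lit_true \<alpha> x" using C \<alpha> unfolding implicate_def by blast
  have cx: "complement x \<notin> C" using C assms(2) by (simp add: implicate_def is_clause_def)
  have "\<not> lit_true ?\<beta> y" if y: "y \<in> C" for y
  proof (cases "y = x")
    case True
    then show ?thesis using x by (cases x) auto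
  next
    case False
    then have "\<not> lit_true \<alpha> y" using \<alpha>(2) y by blast
    \<comment> \<open>\<open>C\<close> has no complementary pair, so the flip touches no other
      literal of \<open>C\<close>.\<close>
    moreover have "lit_var y \<noteq> lit_var x" using False y cx by (cases x; cases y) auto
    ultimately show ?thesis by (cases y) auto
  qed
  then have "\<not> bval b ?\<beta>" using C unfolding implicate_def by blast
  then show ?thesis using that \<alpha>(1) x by blast
qed

lemma prime_implicate_essential:
  assumes "C \<in> prc0 b" "x \<in> C"
  shows "lit_var x \<in> essential b"
proof -
  obtain \<alpha> where \<alpha>: "bval b \<alpha>" "\<not> bval b (\<alpha>(lit_var x := \<not> \<alpha> (lit_var x)))"
    using assms by (rule prime_implicate_literal)
  have "bval b (\<alpha>(lit_var x := True)) \<noteq> bval b (\<alpha>(lit_var x := False))"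
    using \<alpha> fun_upd_triv[of \<alpha> "lit_var x"] by (cases "\<alpha> (lit_var x)") simp_all
  then show ?thesis unfolding essential_def by blast
qed

text \<open>If an essential variable did not occur, the truth of \<open>prc0 b\<close>, and with it
  that of \<open>b\<close>, could not depend on it.\<close>

lemma cls_vars_prc0:
  assumes b: "is_bool_fun b"
  shows "cls_vars (prc0 b) = essential b"
proof
  show "cls_vars (prc0 b) \<subseteq> essential b"
    using prime_implicate_essential unfolding cls_vars_def by blast
  show "essential b \<subseteq> cls_vars (prc0 b)"
  proof
    fix v assume "v \<in> essential b"
    then obtain \<alpha> where \<alpha>: "bval b (\<alpha>(v := True)) \<noteq> bval b (\<alpha>(v := False))"
      unfolding essential_def by blast
    show "v \<in> cls_vars (prc0 b)"
    proof (rule ccontr)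
      assume v: "v \<notin> cls_vars (prc0 b)"
      have "lit_true (\<alpha>(v := True)) x = lit_true (\<alpha>(v := False)) x"
        if "C \<in> prc0 b" "x \<in> C" for C x
      proof -
        have "lit_var x \<noteq> v" using that v unfolding cls_vars_def by blast
        then show ?thesis by (cases x) auto
      qed
      then have "satisfies (\<alpha>(v := True)) (prc0 b) = satisfies (\<alpha>(v := False)) (prc0 b)"
        unfolding satisfies_def by blast
      then show False using \<alpha> satisfies_prc0[OF b] by blast
    qed
  qed
qed

text \<open>Prime implicates use only the finitely many literals over essential variables.\<close>

lemma is_clause_set_prc0:
  assumes "is_bool_fun b"
  shows "is_clause_set (prc0 b)"
proof -
  have "x \<in> Pos ` essential b \<union> Neg ` essential b" if "lit_var x \<in> essential b"
    for x :: "'a literal"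
    using that by (cases x) auto
  then have "prc0 b \<subseteq> Pow (Pos ` essential b \<union> Neg ` essential b)"
    using prime_implicate_essential by blast
  then have "finite (prc0 b)" using finite_essential[OF assms] finite_subset by blast
  then show ?thesis by (simp add: is_clause_set_def prc0_def implicate_def)
qed

lemma is_bool_fun_bf_iff:
  assumes "is_bool_fun b"
  shows "is_bool_fun (bf_iff v b)"
proof -
  have "bval (bf_iff v b) \<alpha> = bval (bf_iff v b) \<beta>"
    if "\<forall>u\<in>bvars (bf_iff v b). \<alpha> u = \<beta> u" for \<alpha> \<beta>
    using that is_bool_fun_cong[OF assms, of \<alpha> \<beta>] by (simp add: bf_iff_def)
  moreover have "finite (bvars (bf_iff v b))"
    using assms by (simp add: bf_iff_def is_bool_fun_def)
  ultimately show ?thesis unfolding is_bool_fun_def by blast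
qed

lemma is_bool_fun_bf_imp:
  assumes "is_bool_fun b"
  shows "is_bool_fun (bf_imp v b)"
proof -
  have "bval (bf_imp v b) \<alpha> = bval (bf_imp v b) \<beta>"
    if "\<forall>u\<in>bvars (bf_imp v b). \<alpha> u = \<beta> u" for \<alpha> \<beta>
    using that is_bool_fun_cong[OF assms, of \<alpha> \<beta>] by (simp add: bf_imp_def)
  moreover have "finite (bvars (bf_imp v b))"
    using assms by (simp add: bf_imp_def is_bool_fun_def)
  ultimately show ?thesis unfolding is_bool_fun_def by blast
qed

text \<open>For a fixed value of \<open>v\<close> the equivalence is \<open>b\<close> or its
  negation, so it depends on \<open>u\<close> exactly when \<open>b\<close> does.\<close>

lemma essential_bf_iff: "u \<noteq> v \<Longrightarrow> u \<in> essential (bf_iff v b) \<longleftrightarrow> u \<in> essential b"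
  unfolding essential_def bf_iff_def by auto

lemma essential_bf_imp: "essential (bf_imp v b) \<subseteq> insert v (essential b)"
  unfolding essential_def bf_imp_def by auto

section \<open>Tseitin translations\<close>

context
  fixes \<C> :: "'v circuit"
  assumes \<C>: "general_circuit \<C>"
begin

section \<open>Variables of the gates\<close>

lemma gate_bool_fun: "v \<in> nodes \<C> \<Longrightarrow> is_bool_fun (gate \<C> v)"
  using \<C> by (simp add: general_circuit_def)

lemma out_node: "out \<C> \<in> nodes \<C>"
  using \<C> by (simp add: general_circuit_def)

lemma underlying_vars_not_nodes: "bvars (underlying \<C>) \<inter> nodes \<C> = {}"
  using \<C> by (auto simp: general_circuit_def underlying_def)

lemma gate_bvars: "v \<in> nodes \<C> \<Longrightarrow> u \<in> bvars (gate \<C> v) \<Longrightarrow>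
    (u, v) \<in> arcs \<C> \<and> u \<in> nodes \<C> \<or> u \<in> inputs \<C> \<and> u \<notin> nodes \<C>"
  using \<C> unfolding general_circuit_def in_nodes_def by blast

text \<open>A gate reading its own node would give a loop among the acyclic arcs.\<close>

lemma node_notin_gate_bvars: "v \<in> nodes \<C> \<Longrightarrow> v \<notin> bvars (gate \<C> v)"
  using gate_bvars[of v v] wf_not_refl[OF wf_arcs[OF \<C>]] by blast

text \<open>An input on which a gate really depends is by definition a variable of the underlying
  function, so once these variables are assigned, only predecessors remain open.\<close>

lemma gate_essential:
  assumes v: "v \<in> nodes \<C>" and u: "u \<in> essential (gate \<C> v)"
  shows "(u, v) \<in> arcs \<C> \<and> u \<in> nodes \<C> \<or> u \<in> bvars (underlying \<C>)"
proof -
  have "u \<in> bvars (gate \<C> v)" using u essential_subset_bvars[OF gate_bool_fun[OF v]] by blast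
  then show ?thesis using gate_bvars[OF v] u v by (auto simp: underlying_def)
qed

lemma essential_gate_subset:
  "v \<in> nodes \<C> \<Longrightarrow> essential (gate \<C> v) \<subseteq> nodes \<C> \<union> bvars (underlying \<C>)"
  using gate_essential by blast

text \<open>Allows \<open>v \<longleftrightarrow> b\<^sub>v\<close> to be violated by changing
  \<open>v\<close> alone while the gate keeps its value.\<close>

lemma bval_gate_upd:
  assumes "v \<in> nodes \<C>"
  shows "bval (gate \<C> v) (\<alpha>(v := x)) = bval (gate \<C> v) \<alpha>"
proof -
  have "\<forall>u\<in>bvars (gate \<C> v). (\<alpha>(v := x)) u = \<alpha> u"
    using node_notin_gate_bvars[OF assms] by auto
  then show ?thesis by (rule is_bool_fun_cong[OF gate_bool_fun[OF assms]])
qed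

section \<open>Finiteness and occurring variables of the translations\<close>

lemma finite_nodes: "finite (nodes \<C>)"
  using \<C> by (simp add: general_circuit_def)

lemma is_clause_set_ts: "is_clause_set (ts \<C>)"
proof -
  have "is_clause_set (prc0 (bf_iff v (gate \<C> v)))" if "v \<in> nodes \<C>" for v
    by (intro is_clause_set_prc0 is_bool_fun_bf_iff gate_bool_fun that)
  then show ?thesis using finite_nodes by (auto simp: ts_def is_clause_set_def is_clause_def)
qed

lemma finite_ts_r: "finite (ts_r \<C>)"
proof -
  have "is_clause_set (prc0 (bf_imp v (gate \<C> v)))" if "v \<in> nodes \<C>" for v
    by (intro is_clause_set_prc0 is_bool_fun_bf_imp gate_bool_fun that)
  then show ?thesis using finite_nodes by (auto simp: ts_r_def is_clause_set_def)
qed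

lemma cls_vars_ts: "cls_vars (ts \<C>) \<subseteq> nodes \<C> \<union> bvars (underlying \<C>)"
proof
  fix u assume "u \<in> cls_vars (ts \<C>)"
  then consider "u = out \<C>" | v where "v \<in> nodes \<C>" "u \<in> cls_vars (prc0 (bf_iff v (gate \<C> v)))"
    by (auto simp: ts_def cls_vars_def)
  then show "u \<in> nodes \<C> \<union> bvars (underlying \<C>)"
  proof cases
    case 1
    then show ?thesis using out_node by simp
  next
    case 2
    then have "u \<in> essential (bf_iff v (gate \<C> v))"
      using cls_vars_prc0[OF is_bool_fun_bf_iff[OF gate_bool_fun]] by blast
    then show ?thesis
      using essential_bf_iff[of u v] essential_gate_subset[OF 2(1)] 2(1) by (cases "u = v") auto
  qed
qed

lemma cls_vars_ts_r: "cls_vars (ts_r \<C>) \<subseteq> nodes \<C> \<union> bvars (underlying \<C>)"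
proof
  fix u assume "u \<in> cls_vars (ts_r \<C>)"
  then consider "u = out \<C>" | v where "v \<in> nodes \<C>" "u \<in> cls_vars (prc0 (bf_imp v (gate \<C> v)))"
    by (auto simp: ts_r_def cls_vars_def)
  then show "u \<in> nodes \<C> \<union> bvars (underlying \<C>)"
  proof cases
    case 1
    then show ?thesis using out_node by simp
  next
    case 2
    then have "u \<in> essential (bf_imp v (gate \<C> v))"
      using cls_vars_prc0[OF is_bool_fun_bf_imp[OF gate_bool_fun]] by blast
    then show ?thesis
      using essential_bf_imp[of v "gate \<C> v"] essential_gate_subset[OF 2(1)] 2(1) by blast
  qed
qed

lemma finite_nodes_underlying_vars: "finite (nodes \<C> \<union> bvars (underlying \<C>))"
  using finite_nodes is_bool_fun_underlying[OF \<C>] by (simp add: is_bool_fun_def)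

lemma finite_cls_vars_apply_ts: "finite (cls_vars (\<phi> \<star> ts \<C>))"
  using cls_vars_apply_passign[of \<phi> "ts \<C>"] cls_vars_ts finite_nodes_underlying_vars
  by (meson Diff_subset finite_subset)

lemma finite_cls_vars_apply_ts_r: "finite (cls_vars (\<phi> \<star> ts_r \<C>))"
  using cls_vars_apply_passign[of \<phi> "ts_r \<C>"] cls_vars_ts_r finite_nodes_underlying_vars
  by (meson Diff_subset finite_subset)

text \<open>Such an input is essential for some gate and, not being a node, also for the equivalence
  at that gate, so it occurs in a prime implicate.\<close>

lemma underlying_vars_subset_ts: "bvars (underlying \<C>) \<subseteq> cls_vars (ts \<C>)"
proof
  fix i assume i: "i \<in> bvars (underlying \<C>)"
  then obtain v where v: "v \<in> nodes \<C>" "i \<in> essential (gate \<C> v)"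
    by (auto simp: underlying_def)
  then have "i \<noteq> v" using i underlying_vars_not_nodes by blast
  then have "i \<in> cls_vars (prc0 (bf_iff v (gate \<C> v)))"
    using v essential_bf_iff[of i v] cls_vars_prc0[OF is_bool_fun_bf_iff[OF gate_bool_fun]] by blast
  then show "i \<in> cls_vars (ts \<C>)" using v(1) by (auto simp: ts_def cls_vars_def)
qed

section \<open>Models of the Tseitin translation\<close>

lemma satisfies_ts:
  "satisfies \<alpha> (ts \<C>) \<longleftrightarrow> \<alpha> (out \<C>) \<and> (\<forall>v\<in>nodes \<C>. \<alpha> v = bval (gate \<C> v) \<alpha>)"
proof -
  have "satisfies \<alpha> (ts \<C>) \<longleftrightarrow>
      \<alpha> (out \<C>) \<and> (\<forall>v\<in>nodes \<C>. satisfies \<alpha> (prc0 (bf_iff v (gate \<C> v))))"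
    by (auto simp: ts_def satisfies_def)
  moreover have "satisfies \<alpha> (prc0 (bf_iff v (gate \<C> v))) \<longleftrightarrow> \<alpha> v = bval (gate \<C> v) \<alpha>"
    if "v \<in> nodes \<C>" for v
    using satisfies_prc0[OF is_bool_fun_bf_iff[OF gate_bool_fun[OF that]]] by (simp add: bf_iff_def)
  ultimately show ?thesis by blast
qed

text \<open>The gate equations are a recursion along well-founded arcs, so they have only one
  solution for given inputs.\<close>

lemma node_val_unique:
  assumes \<alpha>: "\<And>v. v \<in> nodes \<C> \<Longrightarrow> \<alpha> v = bval (gate \<C> v) \<alpha>" and "v \<in> nodes \<C>"
  shows "node_val \<C> \<alpha> v = \<alpha> v"
  using assms(2)
proof (induction v rule: wf_induct_rule[OF wf_arcs[OF \<C>]])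
  case (1 v)
  have "\<forall>u\<in>bvars (gate \<C> v). (if u \<in> nodes \<C> then node_val \<C> \<alpha> u else \<alpha> u) = \<alpha> u"
    using 1 gate_bvars[OF 1(2)] by auto
  then have "bval (gate \<C> v) (\<lambda>u. if u \<in> nodes \<C> then node_val \<C> \<alpha> u else \<alpha> u)
      = bval (gate \<C> v) \<alpha>"
    by (rule is_bool_fun_cong[OF gate_bool_fun[OF 1(2)]])
  then show ?case using \<alpha>[OF 1(2)] node_val_unfold[OF \<C> 1(2)] by simp
qed

lemma satisfiable_ts_iff:
  assumes \<phi>: "dom \<phi> = bvars (underlying \<C>)"
  shows "satisfiable (\<phi> \<star> ts \<C>) \<longleftrightarrow> bval (underlying \<C>) (\<lambda>v. \<phi> v = Some True)"
    (is "_ \<longleftrightarrow> bval _ ?\<phi>")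
proof
  assume "satisfiable (\<phi> \<star> ts \<C>)"
  then obtain \<alpha> where ext: "extends \<alpha> \<phi>" and \<alpha>: "satisfies \<alpha> (ts \<C>)"
    unfolding satisfiable_apply_passign_iff by blast
  have "bval (underlying \<C>) \<alpha>"
    using node_val_unique[OF _ out_node, of \<alpha>] \<alpha> by (simp add: underlying_def satisfies_ts)
  \<comment> \<open>The two may differ on other inputs, but the underlying function does not depend
    on those.\<close>
  moreover have "\<forall>v\<in>bvars (underlying \<C>). \<alpha> v = ?\<phi> v"
    using ext \<phi> unfolding extends_def by (metis (full_types) domD)
  ultimately show "bval (underlying \<C>) ?\<phi>"
    using is_bool_fun_cong[OF is_bool_fun_underlying[OF \<C>], of \<alpha> ?\<phi>] by simp
next
  assume b: "bval (underlying \<C>) ?\<phi>"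
  \<comment> \<open>The model evaluates the circuit: nodes get their computed values, and variables
    that are neither nodes nor assigned by \<open>\<phi>\<close> get False.\<close>
  define \<alpha> where "\<alpha> = (\<lambda>u. if u \<in> nodes \<C> then node_val \<C> ?\<phi> u else ?\<phi> u)"
  have "\<alpha> v = bval (gate \<C> v) \<alpha>" if "v \<in> nodes \<C>" for v
    using node_val_unfold[OF \<C> that, of ?\<phi>] that by (simp add: \<alpha>_def)
  moreover have "\<alpha> (out \<C>)" using b out_node by (simp add: \<alpha>_def underlying_def)
  ultimately have "satisfies \<alpha> (ts \<C>)" by (simp add: satisfies_ts)
  moreover have "extends \<alpha> \<phi>"
    using \<phi> underlying_vars_not_nodes unfolding extends_def \<alpha>_def by auto
  ultimately show "satisfiable (\<phi> \<star> ts \<C>)" unfolding satisfiable_apply_passign_iff by blast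
qed

section \<open>Unit-clause propagation on the Tseitin translation\<close>

lemma ts_residue_assigns_nodes:
  assumes \<theta>: "bvars (underlying \<C>) \<subseteq> dom \<theta>"
    and no_empty: "{} \<notin> \<theta> \<star> ts \<C>" and no_unit: "\<And>x. {x} \<notin> \<theta> \<star> ts \<C>"
    and "v \<in> nodes \<C>"
  shows "v \<in> dom \<theta>"
  using assms(4)
proof (induction v rule: wf_induct_rule[OF wf_arcs[OF \<C>]])
  case (1 v)
  show ?case
  proof (rule ccontr)
    assume v: "v \<notin> dom \<theta>"
    let ?b = "bf_iff v (gate \<C> v)"
    \<comment> \<open>\<open>\<alpha>\<close> agrees with \<open>\<theta>\<close> on all variables
      essential for the gate: those of the underlying function are assigned by assumption,
      predecessors by the induction hypothesis. \<open>\<beta>\<close> then gives \<open>v\<close>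
      the value that contradicts its gate.\<close>
    define \<alpha> where "\<alpha> = (\<lambda>u. \<theta> u = Some True)"
    define \<beta> where "\<beta> = \<alpha>(v := \<not> bval (gate \<C> v) \<alpha>)"
    have "\<not> bval ?b \<beta>"
      using bval_gate_upd[OF 1(2)] by (simp add: bf_iff_def \<beta>_def)
    then obtain C where C: "C \<in> prc0 ?b"
      and f: "\<And>x. x \<in> C \<Longrightarrow> \<not> lit_true \<beta> x \<and> lit_var x \<in> essential ?b"
      using falsified_prime_implicate[OF is_bool_fun_bf_iff[OF gate_bool_fun[OF 1(2)]]] by blast
    have false: "lit_val \<theta> x = Some False" if x: "x \<in> C" "lit_var x \<noteq> v" for x
    proof -
      have "lit_var x \<in> essential (gate \<C> v)" using f[OF x(1)] essential_bf_iff[OF x(2)] by blast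
      then have "lit_var x \<in> dom \<theta>" using gate_essential[OF 1(2)] \<theta> 1 by blast
      then show ?thesis using f[OF x(1)] x(2)
        by (cases x) (auto simp: \<beta>_def \<alpha>_def)
    qed
    have none: "lit_val \<theta> x = None" if "lit_var x = v" for x
      using that v lit_val_None_iff[of \<theta> x] by auto
    have "C \<in> ts \<C>" using C 1(2) by (auto simp: ts_def)
    moreover have "\<forall>x\<in>C. lit_val \<theta> x \<noteq> Some True" using false none by force
    ultimately have D: "{x \<in> C. lit_val \<theta> x \<noteq> Some False} \<in> \<theta> \<star> ts \<C>"
      unfolding apply_passign_def by blast
    \<comment> \<open>Only a literal on \<open>v\<close> can survive in the clause, and its sign is
      fixed because \<open>\<beta>\<close> falsifies it.\<close>
    let ?l = "if \<beta> v then Neg v else Pos v"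
    have "x = ?l" if "x \<in> C" "lit_val \<theta> x \<noteq> Some False" for x
      using false[of x] f[of x] that by (cases x) auto
    then have "{x \<in> C. lit_val \<theta> x \<noteq> Some False} \<subseteq> {?l}" by blast
    from subset_singletonD[OF this] show False
      using D no_empty no_unit by (elim disjE) simp_all
  qed
qed

text \<open>All occurring variables are assigned, so a clause of the residue could only be the empty
  one, which is excluded.\<close>

lemma ts_residue_empty:
  assumes "bvars (underlying \<C>) \<subseteq> dom \<theta>" "{} \<notin> \<theta> \<star> ts \<C>" "\<And>x. {x} \<notin> \<theta> \<star> ts \<C>"
  shows "\<theta> \<star> ts \<C> = {}"
proof -
  have "cls_vars (ts \<C>) \<subseteq> dom \<theta>"
    using cls_vars_ts assms(1) ts_residue_assigns_nodes[OF assms] by blast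
  then have "cls_vars (\<theta> \<star> ts \<C>) = {}" using cls_vars_apply_passign[of \<theta> "ts \<C>"] by blast
  then have "D = {}" if "D \<in> \<theta> \<star> ts \<C>" for D using that unfolding cls_vars_def by blast
  then show ?thesis using assms(2) by blast
qed

text \<open>An empty residue is itself a witness of satisfiability, so the two outcomes of
  propagation match the two cases.\<close>

lemma r1_ts:
  assumes "dom \<phi> = bvars (underlying \<C>)"
  shows "r1 (\<phi> \<star> ts \<C>) = (if satisfiable (\<phi> \<star> ts \<C>) then {} else {{}})"
proof -
  consider "r1 (\<phi> \<star> ts \<C>) = {{}}" "\<not> satisfiable (\<phi> \<star> ts \<C>)"
    | \<psi> where "r1 (\<phi> \<star> ts \<C>) = \<psi> \<star> \<phi> \<star> ts \<C>"
      "{} \<notin> r1 (\<phi> \<star> ts \<C>)" "\<And>x. {x} \<notin> r1 (\<phi> \<star> ts \<C>)"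
    using r1_residue[OF finite_cls_vars_apply_ts] by blast
  then show ?thesis
  proof cases
    case 1
    then show ?thesis by simp
  next
    case 2
    have "bvars (underlying \<C>) \<subseteq> dom (\<psi> ++ \<phi>)" using assms by auto
    then have "\<psi> \<star> \<phi> \<star> ts \<C> = {}"
      using 2 ts_residue_empty[of "\<psi> ++ \<phi>"] by (simp add: apply_passign_map_add)
    moreover from this have "satisfiable (\<phi> \<star> ts \<C>)" unfolding satisfiable_def by blast
    ultimately show ?thesis using 2(1) by simp
  qed
qed

theorem up_representation_ts: "up_representation (ts \<C>) (underlying \<C>)"
  unfolding up_representation_def cnf_representation_def sat_recognition_def usat_recognition_def
  by (intro conjI allI impI)
    (simp_all add: is_clause_set_ts underlying_vars_subset_ts satisfiable_ts_iff r1_ts)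

section \<open>The reduced translation in general NNF\<close>

text \<open>A node is not an input, so its negative literal is constantly false for
  \<open>g\<close>; raising the node can only raise the arguments of \<open>g\<close>.\<close>

lemma mono_gate:
  assumes "general_nnf \<C>" "v \<in> nodes \<C>" "u \<in> nodes \<C>" "bval (gate \<C> v) \<alpha>"
  shows "bval (gate \<C> v) (\<alpha>(u := True))"
proof -
  obtain g :: "('v literal \<Rightarrow> bool) \<Rightarrow> bool" where g: "mono g"
    "\<And>\<alpha>. bval (gate \<C> v) \<alpha> =
      g (\<lambda>x. case x of Pos u \<Rightarrow> \<alpha> u | Neg u \<Rightarrow> u \<in> inputs \<C> \<and> \<not> \<alpha> u)"
    using assms(1,2) unfolding general_nnf_def by blast
  have "u \<notin> inputs \<C>" using \<C> assms(3) unfolding general_circuit_def by blast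
  then have "(\<lambda>x. case x of Pos u \<Rightarrow> \<alpha> u | Neg u \<Rightarrow> u \<in> inputs \<C> \<and> \<not> \<alpha> u)
    \<le> (\<lambda>x. case x of Pos w \<Rightarrow> (\<alpha>(u := True)) w | Neg w \<Rightarrow> w \<in> inputs \<C> \<and> \<not> (\<alpha>(u := True)) w)"
    by (auto simp: le_fun_def split: literal.splits)
  from monoD[OF g(1) this] show ?thesis using assms(4) unfolding g(2) by simp
qed

text \<open>Primality yields a model of \<open>v \<longrightarrow> b\<^sub>v\<close> in which
  \<open>x\<close> is true and which is lost when \<open>x\<close> is flipped; this rules out the
  unwanted signs.\<close>

lemma ts_r_clause_literal:
  assumes nnf: "general_nnf \<C>" and v: "v \<in> nodes \<C>"
    and C: "C \<in> prc0 (bf_imp v (gate \<C> v))" and x: "x \<in> C" "lit_var x \<notin> bvars (underlying \<C>)"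
  shows "x \<in> insert (Neg v) {Pos u | u. (u, v) \<in> arcs \<C>}"
proof -
  let ?b = "bf_imp v (gate \<C> v)"
  obtain \<alpha> where \<alpha>: "bval ?b \<alpha>" "lit_true \<alpha> x" "\<not> bval ?b (\<alpha>(lit_var x := \<not> \<alpha> (lit_var x)))"
    using C x(1) by (rule prime_implicate_literal)
  have ess: "lit_var x \<in> insert v (essential (gate \<C> v))"
    using prime_implicate_essential[OF C x(1)] essential_bf_imp by (rule set_rev_mp)
  show ?thesis
  proof (cases x)
    case (Pos u)
    \<comment> \<open>Flipping \<open>Pos v\<close> makes \<open>v\<close> false, and then the
      implication holds trivially.\<close>
    then have "u \<noteq> v" using \<alpha> by (auto simp: bf_imp_def)
    then show ?thesis using Pos ess gate_essential[OF v] x(2) by auto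
  next
    case (Neg u)
    have "u = v"
    proof (rule ccontr)
      assume "u \<noteq> v"
      then have "u \<in> nodes \<C>" using Neg ess gate_essential[OF v] x(2) by auto
      \<comment> \<open>Flipping \<open>Neg u\<close> raises a node other than \<open>v\<close>,
        which preserves the implication by monotonicity of the gate.\<close>
      then show False
        using mono_gate[OF nnf v, of u \<alpha>] \<alpha> Neg \<open>u \<noteq> v\<close> by (auto simp: bf_imp_def)
    qed
    then show ?thesis using Neg by simp
  qed
qed

text \<open>
  The absence of unit clauses disposes of \<open>{Pos (out \<C>)}\<close>, which does not have the required shape when the
  output has no successor.
\<close>

lemma ts_r_residue_dag_dual_horn:
  assumes nnf: "general_nnf \<C>" and \<theta>: "bvars (underlying \<C>) \<subseteq> dom \<theta>"
    and no_unit: "\<And>x. {x} \<notin> \<theta> \<star> ts_r \<C>"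
  shows "dag_dual_horn (arcs \<C>) (\<theta> \<star> ts_r \<C>)"
  unfolding dag_dual_horn_def
proof
  fix D assume D: "D \<in> \<theta> \<star> ts_r \<C>"
  obtain C where C: "C \<in> ts_r \<C>" "D \<subseteq> C" "\<And>x. x \<in> D \<Longrightarrow> \<theta> (lit_var x) = None"
    using apply_passign_subclause[OF D] by blast
  show "\<exists>v. D \<subseteq> insert (Neg v) {Pos u | u. (u, v) \<in> arcs \<C>}"
  proof (cases "C = {Pos (out \<C>)}")
    case True
    then have "D = {}" using C(2) D no_unit by (metis subset_singletonD)
    then show ?thesis by simp
  next
    case False
    then obtain v where v: "v \<in> nodes \<C>" "C \<in> prc0 (bf_imp v (gate \<C> v))"
      using C(1) by (auto simp: ts_r_def)
    \<comment> \<open>Literals of \<open>D\<close> are unassigned by \<open>\<theta>\<close>, hence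
      not over variables of the underlying function.\<close>
    have "x \<in> insert (Neg v) {Pos u | u. (u, v) \<in> arcs \<C>}" if "x \<in> D" for x
      using ts_r_clause_literal[OF nnf v] C(2) C(3)[OF that] that \<theta> by blast
    then show ?thesis by blast
  qed
qed

text \<open>A residue without refutation is satisfiable and is emptied by pure literal elimination,
  so the absence of a refutation already certifies satisfiability.\<close>

lemma r1_ts_r:
  assumes "general_nnf \<C>" "dom \<phi> = bvars (underlying \<C>)"
  shows "if satisfiable (\<phi> \<star> ts_r \<C>) then r1pl (\<phi> \<star> ts_r \<C>) = {} else r1 (\<phi> \<star> ts_r \<C>) = {{}}"
proof -
  let ?F = "\<phi> \<star> ts_r \<C>"
  consider "r1 ?F = {{}}" "\<not> satisfiable ?F"
    | \<psi> where "r1 ?F = \<psi> \<star> ?F" "{} \<notin> r1 ?F" "\<And>x. {x} \<notin> r1 ?F"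
    using r1_residue[OF finite_cls_vars_apply_ts_r] by blast
  then show ?thesis
  proof cases
    case 1
    then show ?thesis by simp
  next
    case 2
    have "bvars (underlying \<C>) \<subseteq> dom (\<psi> ++ \<phi>)" using assms(2) by auto
    then have horn: "dag_dual_horn (arcs \<C>) (r1 ?F)"
      using ts_r_residue_dag_dual_horn[OF assms(1), of "\<psi> ++ \<phi>"] 2
      by (simp add: apply_passign_map_add)
    have "satisfiable (\<psi> \<star> ?F)" using satisfiable_dag_dual_horn[OF horn 2(2,3)] 2(1) by simp
    then have "satisfiable ?F" by (rule satisfiable_apply_passignD)
    moreover have "finite (r1 ?F)" using 2(1) finite_ts_r finite_apply_passign by metis
    then have "r1pl ?F = {}"
      unfolding r1pl_def using pure_elim_dag_dual_horn[OF _ wf_arcs[OF \<C>] horn 2(2,3)] by blast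
    ultimately show ?thesis by simp
  qed
qed

end

theorem theorem5p13:
  fixes \<C> :: "'v circuit" and f :: "'v bool_fun"
  assumes "general_circuit \<C>"
    and "f = underlying \<C>"
  shows "up_representation (ts \<C>) f \<and>
    (general_nnf \<C> \<longrightarrow>
       usat_recognition r1 (bvars f) (ts_r \<C>) \<and>
       sat_recognition r1pl (bvars f) (ts_r \<C>))"
  unfolding assms(2) usat_recognition_def sat_recognition_def
  using up_representation_ts[OF assms(1)] r1_ts_r[OF assms(1)] by presburger

end
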